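(* Let $X$ be a random element of $\mathbb{R}^d$ with distribution $P$ such that the correlation dimension $\dim_{\mathrm{cd}}(P)$ exists and is finite and strictly positive. Let $X_1,X_2,\dots$ be iid copies of $X$. Let $\beta>0$ and $$r_n=\left(\frac{\log n}{n}\right)^{\frac{1}{(1+\beta)\dim_{\mathrm{cd}}(P)}}.$$ Then the estimator $\widehat{\dim}_{\mathrm{cd}}=\log(\widehat p_n(r_n))/\log(r_n)$ is almost surely consistent, that is, $$\dim_{\mathrm{cd}}(P)=\lim_{n\to\infty}\frac{\log(\widehat p_n(r_n))}{\log(r_n)}\quad\text{a.s.}$$ Also, the same conclusion holds with $r_n$ replaced by any other sequence $r_n^*$ decreasing to zero such that $r_n^*\ge M r_n$ for some $M>0$.
   Context: For $X_1,X_2$ iid with distribution $P$ on $\mathbb{R}^d$, put $p(r)=\mathbb{P}(\|X_1-X_2\|<r)$, where $\|\cdot\|$ is the Euclidean norm. The correlation dimension of $P$ is $\dim_{\mathrm{cd}}(P)=\lim_{r\to0}\frac{\log(p(r))}{\log(r)}$, provided this limit exists (it can be $+\infty$). Its empirical counterpart is $$\widehat p_n(r)=\binom n2^{-1}\sum_{1\le i<j\le n}\mathbb{I}_{\{\|X_i-X_j\|<r\}},$$ so that $\mathbb{E}(\widehat p_n(r))=p(r)$. *)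

theory Defs
  imports "HOL-Probability.Probability"
begin

definition corr_prob :: "(real ^ 'd) measure \<Rightarrow> real \<Rightarrow> real" where
  "corr_prob P r = measure (P \<Otimes>\<^sub>M P) {(x, y). norm (x - y) < r}"

text \<open>
  The limit is taken in the extended reals, so that the dimension may be infinite.
  No extended logarithm is needed: a Borel probability measure on a Euclidean space
  has \<open>corr_prob P r > 0\<close> for every \<open>r > 0\<close>.
\<close>

definition has_corr_dim :: "(real ^ 'd) measure \<Rightarrow> ereal \<Rightarrow> bool" where
  "has_corr_dim P D \<longleftrightarrow>
     ((\<lambda>r. ereal (ln (corr_prob P r) / ln r)) \<longlongrightarrow> D) (at_right 0)"

text \<open>The sample consists of the points \<open>x 1, \<dots>, x n\<close>; the value \<open>x 0\<close> is never used.\<close>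

definition emp_corr_prob :: "(nat \<Rightarrow> real ^ 'd) \<Rightarrow> nat \<Rightarrow> real \<Rightarrow> real" where
  "emp_corr_prob x n r =
     (\<Sum>(i, j)\<in>{(i, j). 1 \<le> i \<and> i < j \<and> j \<le> n}. of_bool (norm (x i - x j) < r))
       / real (n choose 2)"

text \<open>
  If no pair of sample points is closer than \<open>r\<close>, then \<open>ln 0 = 0\<close> gives the value 0 here
  where the usual convention gives \<open>+\<infinity>\<close> (for \<open>r < 1\<close>). Convergence to a limit in
  \<open>(0, \<infinity>)\<close> means the same under both conventions: either value can then
  occur for finitely many \<open>n\<close> only.
\<close>

definition corr_dim_est :: "(nat \<Rightarrow> real ^ 'd) \<Rightarrow> nat \<Rightarrow> real \<Rightarrow> real" where
  "corr_dim_est x n r = ln (emp_corr_prob x n r) / ln r"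

end

theory Submission
  imports Defs "HOL-Real_Asymp.Real_Asymp"
begin

text \<open>
  Sorting the pairs \<open>i < j\<close> by the residue of \<open>i + j\<close> modulo \<open>n\<close> splits the
  complete graph on \<open>{1..n}\<close> into \<open>n\<close> matchings with about \<open>n / 2\<close> edges each. The edges of a
  matching are disjoint, so within one matching the indicators of \<open>\<parallel>X\<^sub>i - X\<^sub>j\<parallel> < r\<close> are independent
  Bernoulli variables with mean \<open>p(r)\<close>, and a multiplicative Chernoff bound applies. By a union
  bound, the empirical value lies in \<open>[p(r) / 2, 2 p(r)]\<close> up to probability
  \<open>2 n exp (- p(r) (n - 3) / 14)\<close>. Since \<open>p(r) \<ge> r powr D'\<close> near \<open>0\<close> for any \<open>D' > D\<close>, choosing
  \<open>D' < (1 + \<beta>) D\<close> makes \<open>n p(r\<^sub>n)\<close> grow at least like a power of \<open>n\<close>, so Borel--Cantelli applies. The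
  factor \<open>2\<close> disappears in the ratio of logarithms because \<open>ln r\<^sub>n \<longlongrightarrow> -\<infinity>\<close>.
\<close>

section \<open>Chernoff bounds for sums of independent Bernoulli variables\<close>

text \<open>Bridge to \<open>Chernoff_ineq_ge\<close> and \<open>Chernoff_ineq_le\<close>, which are
  phrased with integrals over a set.\<close>

lemma set_integrable_whole_space:
  "set_integrable M (space M) f \<longleftrightarrow> integrable M f"
  unfolding set_integrable_def by (rule Bochner_Integration.integrable_cong) auto

context prob_space
begin

text \<open>On {0, 1} the exponential is affine: exp(tY) = 1 + (exp t - 1)Y. Independence then
  factors the expectation, and 1 + x \<le> exp x bounds each factor. The sign of \<open>t\<close> is
  free, so both tails are served.\<close>

lemma mgf_sum_bernoulli_le:
  fixes Y :: "'i \<Rightarrow> 'a \<Rightarrow> real"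
  assumes fin: "finite J" and indep: "indep_vars (\<lambda>_. borel) Y J"
    and zero_one: "\<And>j \<omega>. Y j \<omega> \<in> {0, 1}"
    and mean: "\<And>j. j \<in> J \<Longrightarrow> expectation (Y j) = p"
  shows "integrable M (\<lambda>\<omega>. exp (t * (\<Sum>j\<in>J. Y j \<omega>)))"
    and "expectation (\<lambda>\<omega>. exp (t * (\<Sum>j\<in>J. Y j \<omega>))) \<le> exp (p * card J * (exp t - 1))"
proof -
  define Z where "Z j \<omega> = 1 + (exp t - 1) * Y j \<omega>" for j \<omega>
  have exp_eq: "exp (t * (\<Sum>j\<in>J. Y j \<omega>)) = (\<Prod>j\<in>J. Z j \<omega>)" for \<omega>
  proof -
    have "exp (t * Y j \<omega>) = Z j \<omega>" for j
      using zero_one[of j \<omega>] by (auto simp: Z_def)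
    then show ?thesis
      using fin by (simp add: sum_distrib_left exp_sum)
  qed
  have [measurable]: "Y j \<in> borel_measurable M" if "j \<in> J" for j
    using indep that by (auto simp: indep_vars_def)
  have int_Y: "integrable M (Y j)" if "j \<in> J" for j
  proof (rule integrable_const_bound[where B = 1])
    have "norm (Y j \<omega>) \<le> 1" for \<omega>
      using zero_one[of j \<omega>] by auto
    then show "AE \<omega> in M. norm (Y j \<omega>) \<le> 1"
      by simp
  qed (use that in measurable)
  have int_Z: "integrable M (Z j)" if "j \<in> J" for j
    unfolding Z_def using int_Y[OF that] by simp
  have indep_Z: "indep_vars (\<lambda>_. borel) Z J"
    unfolding Z_def by (rule indep_vars_compose2[OF indep]) auto
  show "integrable M (\<lambda>\<omega>. exp (t * (\<Sum>j\<in>J. Y j \<omega>)))"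
    unfolding exp_eq by (rule indep_vars_integrable[OF fin indep_Z int_Z])
  have EZ: "expectation (Z j) = 1 + (exp t - 1) * p" if "j \<in> J" for j
    unfolding Z_def using int_Y[OF that] mean[OF that] by (simp add: prob_space)
  \<comment> \<open>An index in \<open>J\<close> is required: for empty \<open>J\<close> nothing
    ties \<open>p\<close> to an expectation.\<close>
  have p01: "0 \<le> p \<and> p \<le> 1" if "j \<in> J" for j
  proof -
    have Y01: "0 \<le> Y j \<omega>" "Y j \<omega> \<le> 1" for \<omega>
      using zero_one[of j \<omega>] by auto
    have "0 \<le> expectation (Y j)"
      by (intro Bochner_Integration.integral_nonneg Y01)
    moreover have "expectation (Y j) \<le> expectation (\<lambda>_. 1)"
      by (intro integral_mono int_Y[OF that] Y01) auto
    ultimately show ?thesis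
      using mean[OF that] by (simp add: prob_space)
  qed
  \<comment> \<open>\<open>prod_mono\<close> asks for nonnegative factors; each factor is a convex
    combination of 1 and \<open>exp t\<close>, which settles negative \<open>t\<close> too.\<close>
  have nonneg: "0 \<le> 1 + (exp t - 1) * p" if "j \<in> J" for j
  proof -
    have "0 \<le> (1 - p) + exp t * p"
      using p01[OF that] by simp
    then show ?thesis
      by (simp add: algebra_simps)
  qed
  have "expectation (\<lambda>\<omega>. exp (t * (\<Sum>j\<in>J. Y j \<omega>))) = (\<Prod>j\<in>J. 1 + (exp t - 1) * p)"
    unfolding exp_eq using indep_vars_lebesgue_integral[OF fin indep_Z int_Z] EZ by simp
  also have "\<dots> \<le> (\<Prod>j\<in>J. exp ((exp t - 1) * p))"
    by (intro prod_mono) (use nonneg in \<open>auto intro: exp_ge_add_one_self\<close>)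
  also have "\<dots> = exp (p * card J * (exp t - 1))"
    by (simp add: exp_of_nat_mult[symmetric] mult_ac)
  finally show "expectation (\<lambda>\<omega>. exp (t * (\<Sum>j\<in>J. Y j \<omega>))) \<le> exp (p * card J * (exp t - 1))" .
qed

lemma bernoulli_chernoff:
  fixes Y :: "'i \<Rightarrow> 'a \<Rightarrow> real"
  assumes fin: "finite J" and indep: "indep_vars (\<lambda>_. borel) Y J"
    and zero_one: "\<And>j \<omega>. Y j \<omega> \<in> {0, 1}"
    and mean: "\<And>j. j \<in> J \<Longrightarrow> expectation (Y j) = p" and p: "0 \<le> p"
  defines "S \<equiv> \<lambda>\<omega>. \<Sum>j\<in>J. Y j \<omega>"
  shows "prob {\<omega>\<in>space M. S \<omega> \<ge> 2 * p * card J} \<le> exp (- p * card J / 7)" (is ?upper)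
    and "prob {\<omega>\<in>space M. S \<omega> \<le> p * card J / 2} \<le> exp (- p * card J / 7)" (is ?lower)
proof -
  \<comment> \<open>Both tails use the exponential moment at \<open>\<plusminus> ln 2\<close>: the exponents \<open>2 ln 2 - 1\<close> and
    \<open>(1 - ln 2) / 2\<close> are both at least \<open>1 / 7\<close>.\<close>
  note mgf = mgf_sum_bernoulli_le[OF fin indep zero_one mean]
  have ln2: "2 / 3 \<le> ln (2::real)" "ln (2::real) \<le> 25 / 36"
    by (rule ln2_ge_two_thirds, rule ln2_le_25_over_36)
  have half: "exp (- ln 2) = (1 / 2 :: real)"
    by (simp add: exp_minus)
  define m where "m = p * real (card J)"
  have m: "0 \<le> m"
    using p by (simp add: m_def)
  have "prob {\<omega>\<in>space M. S \<omega> \<ge> 2 * m}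
      \<le> exp (- ln 2 * (2 * m)) * expectation (\<lambda>\<omega>. exp (ln 2 * S \<omega>))"
    using Chernoff_ineq_ge[of "ln 2" "space M" S "2 * m"] mgf(1)[of "ln 2"]
    by (simp add: S_def set_integrable_whole_space set_integral_space)
  also have "\<dots> \<le> exp (- ln 2 * (2 * m)) * exp (m * (exp (ln 2) - 1))"
    unfolding m_def S_def using mgf(2)[of "ln 2"] by (intro mult_left_mono) auto
  also have "\<dots> = exp (- m * (2 * ln 2 - 1))"
    by (simp add: exp_add[symmetric] algebra_simps)
  also have "\<dots> \<le> exp (- m / 7)"
    using mult_left_mono[of "1 / 7" "2 * ln 2 - 1" m] ln2 m by simp
  finally show ?upper
    by (simp add: m_def mult.assoc)
  have "prob {\<omega>\<in>space M. S \<omega> \<le> m / 2}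
      \<le> exp (ln 2 * (m / 2)) * expectation (\<lambda>\<omega>. exp (- ln 2 * S \<omega>))"
    using Chernoff_ineq_le[of "ln 2" "space M" S "m / 2"] mgf(1)[of "- ln 2"]
    by (simp add: S_def set_integrable_whole_space set_integral_space)
  also have "\<dots> \<le> exp (ln 2 * (m / 2)) * exp (m * (exp (- ln 2) - 1))"
    unfolding m_def S_def using mgf(2)[of "- ln 2"] by (intro mult_left_mono) auto
  also have "\<dots> = exp (- m * ((1 - ln 2) / 2))"
    by (simp add: half exp_add[symmetric] algebra_simps diff_divide_distrib)
  also have "\<dots> \<le> exp (- m / 7)"
    using mult_left_mono[of "1 / 7" "(1 - ln 2) / 2" m] ln2 m by simp
  finally show ?lower
    by (simp add: m_def mult.assoc)
qed

end

section \<open>Splitting the pairs into matchings\<close>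

definition residue_matching :: "nat \<Rightarrow> nat \<Rightarrow> (nat \<times> nat) set" where
  "residue_matching n s = {(i, j). 1 \<le> i \<and> i < j \<and> j \<le> n \<and> (i + j) mod n = s}"

lemma finite_residue_matching [simp]: "finite (residue_matching n s)"
  by (rule finite_subset[of _ "{..n} \<times> {..n}"]) (auto simp: residue_matching_def)

lemma pairs_eq_UN_residue_matching:
  "{(i, j). 1 \<le> i \<and> i < j \<and> j \<le> n} = (\<Union>s<n. residue_matching n s)"
  by (auto simp: residue_matching_def)

lemma residue_matching_disjoint:
  "disjoint_family_on (residue_matching n) A"
  by (auto simp: disjoint_family_on_def residue_matching_def)

text \<open>One endpoint and the residue determine the other endpoint, because 1, ..., n are
  pairwise incongruent modulo n.\<close>

lemma mod_add_left_inj: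
  fixes i j k n :: nat
  assumes "(i + j) mod n = (i + k) mod n" "1 \<le> j" "j \<le> n" "1 \<le> k" "k \<le> n"
  shows "j = k"
proof -
  have "j \<le> k \<Longrightarrow> j = k" if "(i + j) mod n = (i + k) mod n" "1 \<le> j" "k \<le> n" for j k
  proof -
    assume "j \<le> k"
    with that have "n dvd (i + k) - (i + j)"
      by (metis add_le_cancel_left mod_eq_dvd_iff_nat)
    then have "n dvd k - j" by simp
    moreover have "k - j < n" using that \<open>j \<le> k\<close> by linarith
    ultimately show "j = k" using \<open>j \<le> k\<close> by (auto dest: dvd_imp_le)
  qed
  from this[of j k] this[of k j] show ?thesis using assms by (metis nat_le_linear)
qed

text \<open>If two edges share a vertex, cancelling it modulo n shows that they share the other one
  as well. The orientation i < j rules out a swapped copy, so the edges coincide.\<close>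

lemma residue_matching_pairwise_disjoint:
  "disjoint_family_on (\<lambda>(i, j). {i, j}) (residue_matching n s)"
proof -
  have "{i, j} \<inter> {i', j'} = {}"
    if e: "1 \<le> i" "i < j" "j \<le> n" "(i + j) mod n = s"
          "1 \<le> i'" "i' < j'" "j' \<le> n" "(i' + j') mod n = s"
      and ne: "(i, j) \<noteq> (i', j')" for i j i' j'
  proof -
    have "i \<noteq> i'" using mod_add_left_inj[of i j n j'] e ne by auto
    moreover have "j \<noteq> j'" using mod_add_left_inj[of j i n i'] e ne by (auto simp: add.commute)
    moreover have "i \<noteq> j'" using mod_add_left_inj[of i j n i'] e ne by (auto simp: add.commute)
    moreover have "j \<noteq> i'" using mod_add_left_inj[of j i n j'] e ne by (auto simp: add.commute)
    ultimately show ?thesis by auto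
  qed
  then show ?thesis
    unfolding disjoint_family_on_def residue_matching_def by fast
qed

text \<open>Endpoints are counted: all but at most three vertices lie on an edge, and an edge has
  two endpoints.\<close>

lemma card_residue_matching_ge:
  assumes "s < n"
  shows "n \<le> 2 * card (residue_matching n s) + 3"
proof -
  define E where "E = residue_matching n s"
  \<comment> \<open>The partner of \<open>i\<close> is \<open>s - i\<close> or \<open>s + n - i\<close>; the listed vertices are those that may
    be their own partner, together with \<open>n\<close>, which has no partner in range if \<open>s = 0\<close>.\<close>
  have cover: "{1..n} \<subseteq> fst ` E \<union> snd ` E \<union> {s div 2, (s + n) div 2, n}"
  proof
    fix i assume i: "i \<in> {1..n}"
    define j where "j = (if i < s then s - i else s + n - i)"
    show "i \<in> fst ` E \<union> snd ` E \<union> {s div 2, (s + n) div 2, n}"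
    proof (cases "i = j \<or> i = n")
      case True
      then show ?thesis by (auto simp: j_def split: if_splits)
    next
      case False
      then have j: "1 \<le> j" "j \<le> n" "(i + j) mod n = s"
        using i assms by (auto simp: j_def)
      then have "(i, j) \<in> E \<or> (j, i) \<in> E"
        using False i by (auto simp: E_def residue_matching_def add.commute)
      then show ?thesis by force
    qed
  qed
  have fin: "finite E"
    by (simp add: E_def)
  have "n = card {1..n}" by simp
  also have "\<dots> \<le> card (fst ` E \<union> snd ` E \<union> {s div 2, (s + n) div 2, n})"
    using fin by (intro card_mono cover) auto
  also have "\<dots> \<le> card (fst ` E) + card (snd ` E) + card {s div 2, (s + n) div 2, n}"
    by (meson add_le_mono1 card_Un_le order_trans)
  also have "\<dots> \<le> card E + card E + 3"
    using fin by (intro add_mono card_image_le) (auto simp: card_insert_if)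
  finally show ?thesis by (simp add: E_def)
qed


section \<open>The empirical correlation probability over matchings\<close>

definition near :: "real \<Rightarrow> (nat \<Rightarrow> 'b::real_normed_vector) \<Rightarrow> nat \<times> nat \<Rightarrow> real" where
  "near r x = (\<lambda>(i, j). of_bool (norm (x i - x j) < r))"

lemma near_zero_one: "near r x e \<in> {0, 1}"
  by (auto simp: near_def split: prod.split)

text \<open>Numerator and denominator split over the same matchings, so bounds proportional to
  \<open>card\<close> on each matching pass to the quotient.\<close>

lemma emp_corr_prob_eq_sum_matchings:
  "emp_corr_prob x n r =
     (\<Sum>s<n. \<Sum>e\<in>residue_matching n s. near r x e) / (\<Sum>s<n. real (card (residue_matching n s)))"
proof -
  define Q where "Q = {(i, j). 1 \<le> i \<and> i < j \<and> j \<le> n}"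
  have Q: "Q = (\<Union>s<n. residue_matching n s)"
    unfolding Q_def by (rule pairs_eq_UN_residue_matching)
  have disj: "\<forall>s\<in>{..<n}. \<forall>t\<in>{..<n}. s \<noteq> t \<longrightarrow> residue_matching n s \<inter> residue_matching n t = {}"
    using residue_matching_disjoint[of n "{..<n}"] by (simp add: disjoint_family_on_def)
  have "sum (near r x) Q = (\<Sum>s<n. \<Sum>e\<in>residue_matching n s. near r x e)"
    unfolding Q by (rule sum.UNION_disjoint) (use disj in auto)
  moreover have "card Q = (\<Sum>s<n. card (residue_matching n s))"
    unfolding Q by (rule card_UN_disjoint) (use disj in auto)
  moreover have "card Q = n choose 2"
  proof -
    have "bij_betw (\<lambda>(i, j). {i, j}) Q {B. B \<subseteq> {1..n} \<and> card B = 2}"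
    proof (rule bij_betwI')
      fix e f assume "e \<in> Q" "f \<in> Q"
      then show "((\<lambda>(i, j). {i, j}) e = (\<lambda>(i, j). {i, j}) f) = (e = f)"
        by (auto simp: Q_def doubleton_eq_iff)
    next
      fix e assume "e \<in> Q"
      then show "(\<lambda>(i, j). {i, j}) e \<in> {B. B \<subseteq> {1..n} \<and> card B = 2}"
        by (auto simp: Q_def)
    next
      fix B assume "B \<in> {B. B \<subseteq> {1..n} \<and> card B = 2}"
      then obtain a b where B: "B = {a, b}" "a \<noteq> b" "a \<in> {1..n}" "b \<in> {1..n}"
        by (auto simp: card_2_iff)
      then have "(min a b, max a b) \<in> Q" "B = {min a b, max a b}"
        by (auto simp: Q_def min_def max_def)
      then show "\<exists>e\<in>Q. B = (\<lambda>(i, j). {i, j}) e"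
        by force
    qed
    then have "card Q = card {B. B \<subseteq> {1..n} \<and> card B = 2}"
      by (rule bij_betw_same_card)
    also have "\<dots> = n choose 2"
      by (subst n_subsets) auto
    finally show ?thesis .
  qed
  ultimately show ?thesis
    unfolding emp_corr_prob_def Q_def[symmetric] near_def[symmetric]
    by (simp flip: of_nat_sum)
qed

lemma emp_corr_prob_bounds:
  fixes p :: real
  assumes n: "2 \<le> n"
    and lower: "\<And>s. s < n \<Longrightarrow> p * card (residue_matching n s) / 2 \<le> (\<Sum>e\<in>residue_matching n s. near r x e)"
    and upper: "\<And>s. s < n \<Longrightarrow> (\<Sum>e\<in>residue_matching n s. near r x e) \<le> 2 * p * card (residue_matching n s)"
  shows "p / 2 \<le> emp_corr_prob x n r" "emp_corr_prob x n r \<le> 2 * p"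
proof -
  define c where "c = (\<Sum>s<n. real (card (residue_matching n s)))"
  \<comment> \<open>One explicit edge suffices for a positive denominator.\<close>
  have "(1, 2) \<in> residue_matching n (3 mod n)"
    using n by (simp add: residue_matching_def)
  then have "0 < real (card (residue_matching n (3 mod n)))"
    by (auto simp: card_gt_0_iff)
  also have "\<dots> \<le> c"
    unfolding c_def using n by (intro member_le_sum) auto
  finally have c: "0 < c" .
  have "p / 2 * c = (\<Sum>s<n. p * card (residue_matching n s) / 2)"
    by (simp add: c_def sum_distrib_left)
  also have "\<dots> \<le> (\<Sum>s<n. \<Sum>e\<in>residue_matching n s. near r x e)"
    by (intro sum_mono lower) auto
  finally show "p / 2 \<le> emp_corr_prob x n r"
    unfolding emp_corr_prob_eq_sum_matchings c_def[symmetric] using c by (simp add: pos_le_divide_eq)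
  have "(\<Sum>s<n. \<Sum>e\<in>residue_matching n s. near r x e) \<le> (\<Sum>s<n. 2 * p * card (residue_matching n s))"
    by (intro sum_mono upper) auto
  also have "\<dots> = 2 * p * c"
    by (simp add: c_def sum_distrib_left)
  finally show "emp_corr_prob x n r \<le> 2 * p"
    unfolding emp_corr_prob_eq_sum_matchings c_def[symmetric] using c by (simp add: pos_divide_le_eq)
qed

section \<open>Independence along a matching and the deviation bound\<close>

context prob_space
begin

text \<open>Disjoint pairs read disjoint blocks of an independent family, and functions of disjoint
  blocks are independent.\<close>

lemma indep_vars_near:
  fixes X :: "nat \<Rightarrow> 'a \<Rightarrow> 'b::{real_normed_vector, second_countable_topology}"
  assumes indep: "indep_vars (\<lambda>_. borel) X I"
    and E: "E \<subseteq> I \<times> I" "disjoint_family_on (\<lambda>(i, j). {i, j}) E"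
  shows "indep_vars (\<lambda>_. borel) (\<lambda>e \<omega>. near r (\<lambda>i. X i \<omega>) e) E"
proof -
  let ?K = "\<lambda>(i, j). {i, j}"
  have "indep_vars (\<lambda>e. PiM (?K e) (\<lambda>_. borel)) (\<lambda>e \<omega>. restrict (\<lambda>i. X i \<omega>) (?K e)) E"
    by (rule indep_vars_restrict[OF indep]) (use E in auto)
  then have "indep_vars (\<lambda>_. borel) (\<lambda>e \<omega>. near r (restrict (\<lambda>i. X i \<omega>) (?K e)) e) E"
  proof (rule indep_vars_compose2)
    fix e :: "nat \<times> nat"
    obtain i j where e: "e = (i, j)" by force
    have [measurable]: "(\<lambda>f. f i) \<in> PiM {i, j} (\<lambda>_. borel :: 'b measure) \<rightarrow>\<^sub>M borel"
      "(\<lambda>f. f j) \<in> PiM {i, j} (\<lambda>_. borel :: 'b measure) \<rightarrow>\<^sub>M borel"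
      by (rule measurable_component_singleton, simp)+
    show "(\<lambda>f. near r f e) \<in> PiM (?K e) (\<lambda>_. borel :: 'b measure) \<rightarrow>\<^sub>M borel"
      unfolding e near_def by simp
  qed
  also have "(\<lambda>e \<omega>. near r (restrict (\<lambda>i. X i \<omega>) (?K e)) e) = (\<lambda>e \<omega>. near r (\<lambda>i. X i \<omega>) e)"
    by (auto simp: fun_eq_iff near_def)
  finally show ?thesis .
qed

lemma expectation_near:
  fixes X :: "nat \<Rightarrow> 'a \<Rightarrow> real ^ 'd"
  assumes indep: "indep_vars (\<lambda>_. borel) X I"
    and ij: "i \<in> I" "j \<in> I" "i \<noteq> j"
    and distr: "distr M borel (X i) = P" "distr M borel (X j) = P"
  shows "expectation (\<lambda>\<omega>. near r (\<lambda>i. X i \<omega>) (i, j)) = corr_prob P r"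
proof -
  \<comment> \<open>Pairwise independence is extracted from the family through the singleton blocks
    {i} and {j}; it makes the joint law the product of \<open>P\<close> with itself.\<close>
  have "indep_var borel ((\<lambda>f. f i) \<circ> (\<lambda>\<omega>. restrict (\<lambda>i. X i \<omega>) {i}))
      borel ((\<lambda>f. f j) \<circ> (\<lambda>\<omega>. restrict (\<lambda>i. X i \<omega>) {j}))"
    using ij by (intro indep_var_compose[OF indep_var_restrict[OF indep]]) auto
  then have iv: "indep_var borel (X i) borel (X j)"
    by (simp add: comp_def)
  then have [measurable]: "X i \<in> borel_measurable M" "X j \<in> borel_measurable M"
    by (auto dest: indep_var_rv1 indep_var_rv2)
  have PP: "P \<Otimes>\<^sub>M P = distr M (borel \<Otimes>\<^sub>M borel) (\<lambda>\<omega>. (X i \<omega>, X j \<omega>))"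
    using iv unfolding indep_var_distribution_eq by (simp add: distr)
  have meas: "{(x, y). norm (x - y) < r} \<in> sets (borel \<Otimes>\<^sub>M (borel :: (real ^ 'd) measure))"
    unfolding borel_prod case_prod_beta by (intro borel_open open_Collect_less continuous_intros)
  have "corr_prob P r = prob {\<omega>\<in>space M. norm (X i \<omega> - X j \<omega>) < r}"
    unfolding corr_prob_def PP
    by (subst measure_distr) (use meas in \<open>auto simp: vimage_def Int_def conj_commute\<close>)
  also have "\<dots> = expectation (indicator {\<omega>\<in>space M. norm (X i \<omega> - X j \<omega>) < r})"
    by simp
  also have "\<dots> = expectation (\<lambda>\<omega>. near r (\<lambda>i. X i \<omega>) (i, j))"
    by (rule Bochner_Integration.integral_cong) (auto simp: near_def indicator_def)
  finally show ?thesis ..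
qed

text \<open>The exceptional event collects two tails for each of the n matchings, whence the factor
  \<open>2 * real n\<close>. It is delivered as a measurable set, ready for Borel-Cantelli.\<close>

lemma emp_corr_prob_deviation:
  fixes X :: "nat \<Rightarrow> 'a \<Rightarrow> real ^ 'd"
  assumes indep: "indep_vars (\<lambda>_. borel) X {1..}"
    and distr: "\<And>i. 1 \<le> i \<Longrightarrow> distr M borel (X i) = P"
    and n: "2 \<le> n"
  obtains A where "A \<in> events"
    and "prob A \<le> 2 * real n * exp (- corr_prob P r * (real n - 3) / 14)"
    and "\<And>\<omega>. \<omega> \<in> space M - A \<Longrightarrow> corr_prob P r / 2 \<le> emp_corr_prob (\<lambda>i. X i \<omega>) n r \<and>
      emp_corr_prob (\<lambda>i. X i \<omega>) n r \<le> 2 * corr_prob P r"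
proof -
  define p where "p = corr_prob P r"
  define E where "E = residue_matching n"
  define S where "S s \<omega> = (\<Sum>e\<in>E s. near r (\<lambda>i. X i \<omega>) e)" for s \<omega>
  define U where "U s = {\<omega>\<in>space M. S s \<omega> \<ge> 2 * p * card (E s)}" for s
  define L where "L s = {\<omega>\<in>space M. S s \<omega> \<le> p * card (E s) / 2}" for s
  define A where "A = (\<Union>s<n. U s \<union> L s)"
  have p: "0 \<le> p"
    by (simp add: p_def corr_prob_def)
  have indep_E: "indep_vars (\<lambda>_. borel) (\<lambda>e \<omega>. near r (\<lambda>i. X i \<omega>) e) (E s)" for s
    unfolding E_def
    by (rule indep_vars_near[OF indep _ residue_matching_pairwise_disjoint])
       (auto simp: residue_matching_def)
  have mean: "expectation (\<lambda>\<omega>. near r (\<lambda>i. X i \<omega>) e) = p" if "e \<in> E s" for e s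
    using that unfolding E_def p_def residue_matching_def
    by (auto intro!: expectation_near[OF indep] distr)
  have meas: "S s \<in> borel_measurable M" for s
    unfolding S_def using indep_E[of s] by (intro borel_measurable_sum) (auto simp: indep_vars_def)
  have sets: "U s \<in> events" "L s \<in> events" for s
    using meas[of s] unfolding U_def L_def by measurable
  have tail: "prob (U s \<union> L s) \<le> 2 * exp (- p * (real n - 3) / 14)" if s: "s < n" for s
  proof -
    have finE: "finite (E s)" by (simp add: E_def)
    note ch = bernoulli_chernoff[OF finE indep_E near_zero_one mean[of _ s] p, folded S_def, folded U_def L_def]
    \<comment> \<open>A matching has at least (n - 3) / 2 edges, which turns the 7 of the Chernoff
      bound into 14.\<close>
    have "p * (real n - 3) \<le> p * (2 * real (card (E s)))"
      using card_residue_matching_ge[OF s] p unfolding E_def by (intro mult_left_mono) auto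
    then have "exp (- p * card (E s) / 7) \<le> exp (- p * (real n - 3) / 14)"
      by simp
    then show ?thesis
      using ch measure_Un_le[OF sets, of s s] by linarith
  qed
  show ?thesis
  proof (rule that)
    show "A \<in> events"
      unfolding A_def using sets by auto
    have "prob A \<le> (\<Sum>s<n. prob (U s \<union> L s))"
      unfolding A_def using sets by (intro finite_measure_subadditive_finite) auto
    also have "\<dots> \<le> (\<Sum>s<n. 2 * exp (- p * (real n - 3) / 14))"
      by (intro sum_mono tail) auto
    finally show "prob A \<le> 2 * real n * exp (- corr_prob P r * (real n - 3) / 14)"
      by (simp add: p_def)
  next
    fix \<omega> assume "\<omega> \<in> space M - A"
    then have "p * card (E s) / 2 \<le> S s \<omega>" "S s \<omega> \<le> 2 * p * card (E s)" if "s < n" for s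
      using that by (force simp: A_def U_def L_def)+
    then show "corr_prob P r / 2 \<le> emp_corr_prob (\<lambda>i. X i \<omega>) n r \<and>
        emp_corr_prob (\<lambda>i. X i \<omega>) n r \<le> 2 * corr_prob P r"
      using emp_corr_prob_bounds[OF n, of p r "\<lambda>i. X i \<omega>"]
      unfolding p_def[symmetric] S_def E_def by blast
  qed
qed

end

section \<open>Small-radius behaviour of \<open>corr_prob\<close> and limits of log ratios\<close>

lemma has_corr_dim_iff:
  "has_corr_dim P (ereal D) \<longleftrightarrow> ((\<lambda>r. ln (corr_prob P r) / ln r) \<longlongrightarrow> D) (at_right 0)"
  by (simp add: has_corr_dim_def)

lemma eventually_at_right_0_less_1: "eventually (\<lambda>r::real. 0 < r \<and> r < 1) (at_right 0)"
  by (auto simp: eventually_at_right_field intro!: exI[of _ 1])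

lemma has_corr_dim_imp_corr_prob_pos:
  assumes "has_corr_dim P (ereal D)" "0 < D"
  shows "eventually (\<lambda>r. 0 < corr_prob P r) (at_right 0)"
proof -
  have "eventually (\<lambda>r. 0 < ln (corr_prob P r) / ln r) (at_right 0)"
    using order_tendstoD(1)[OF assms(1)[unfolded has_corr_dim_iff] assms(2)] .
  then show ?thesis
  proof eventually_elim
    case (elim r)
    \<comment> \<open>By \<open>ln 0 = 0\<close> a vanishing probability would make the ratio 0, but
      here it is positive.\<close>
    then have "corr_prob P r \<noteq> 0" by auto
    then show ?case
      by (simp add: corr_prob_def zero_less_measure_iff)
  qed
qed

text \<open>Near 0 the ratio of logarithms is below \<open>D'\<close>; multiplying by
  \<open>ln r\<close> < 0 reverses the inequality.\<close>

lemma has_corr_dim_imp_powr_le_corr_prob: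
  assumes "has_corr_dim P (ereal D)" "0 < D" "D < D'"
  shows "eventually (\<lambda>r. r powr D' \<le> corr_prob P r) (at_right 0)"
  using order_tendstoD(2)[OF assms(1)[unfolded has_corr_dim_iff] assms(3)]
    has_corr_dim_imp_corr_prob_pos[OF assms(1,2)] eventually_at_right_0_less_1
proof eventually_elim
  case (elim r)
  then have "D' * ln r \<le> ln (corr_prob P r)"
    by (simp add: divide_simps ln_less_zero split: if_splits)
  then have "exp (D' * ln r) \<le> exp (ln (corr_prob P r))" by simp
  then show ?case
    using elim by (simp add: powr_def)
qed

lemma tendsto_ln_ratio_perturb:
  fixes p q r :: "nat \<Rightarrow> real"
  assumes lim: "(\<lambda>n. ln (p n) / ln (r n)) \<longlonglongrightarrow> D"
    and r: "filterlim r (at_right 0) sequentially"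
    and pos: "eventually (\<lambda>n. 0 < p n) sequentially"
    and pq: "eventually (\<lambda>n. p n / 2 \<le> q n \<and> q n \<le> 2 * p n) sequentially"
  shows "(\<lambda>n. ln (q n) / ln (r n)) \<longlonglongrightarrow> D"
proof -
  have ln_r: "filterlim (\<lambda>n. ln (r n)) at_bot sequentially"
    by (rule filterlim_compose[OF ln_at_0 r])
  have "(\<lambda>n. ln 2 / ln (r n)) \<longlonglongrightarrow> 0"
    by (rule tendsto_divide_0[OF tendsto_const])
       (rule filterlim_at_bot_imp_at_infinity[OF ln_r])
  then have bound: "(\<lambda>n. \<bar>ln 2 / ln (r n)\<bar>) \<longlonglongrightarrow> 0"
    by (rule tendsto_rabs_zero)
  have close: "eventually (\<lambda>n. \<bar>ln (q n) - ln (p n)\<bar> \<le> ln 2) sequentially"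
    using pos pq
  proof eventually_elim
    case (elim n)
    then have "ln (p n / 2) \<le> ln (q n)" "ln (q n) \<le> ln (2 * p n)"
      by (auto intro!: ln_mono)
    with elim show ?case
      by (simp add: ln_div ln_mult abs_le_iff)
  qed
  have "(\<lambda>n. (ln (q n) - ln (p n)) / ln (r n)) \<longlonglongrightarrow> 0"
  proof (rule Lim_null_comparison[OF _ bound])
    show "eventually (\<lambda>n. norm ((ln (q n) - ln (p n)) / ln (r n)) \<le> \<bar>ln 2 / ln (r n)\<bar>) sequentially"
      using close by eventually_elim (auto simp: abs_divide intro!: divide_right_mono)
  qed
  from tendsto_add[OF lim this] show ?thesis
    by (simp add: diff_divide_distrib)
qed

text \<open>Up to a constant, the exponent is at least n powr (1 - g) times a power of ln n. As g <
  1, this outgrows every multiple of ln n, so the terms fall below 1 / n^2.\<close>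

lemma summable_stretched_exp:
  fixes p :: "nat \<Rightarrow> real"
  assumes K: "0 < K" and g: "g < 1"
    and p: "eventually (\<lambda>n. K * (ln (real n) / real n) powr g \<le> p n) sequentially"
  shows "summable (\<lambda>n. 2 * real n * exp (- p n * (real n - 3) / 14))"
proof (rule summable_comparison_test_ev)
  show "summable (\<lambda>n. 1 / real n ^ 2)"
    using inverse_power_summable[of 2, where ?'a = real] by (simp add: inverse_eq_divide)
  have "eventually (\<lambda>n::nat. 2 * real n * exp (- (K * (ln (real n) / real n) powr g) * (real n - 3) / 14)
      \<le> 1 / real n ^ 2) sequentially"
    using K g by real_asymp
  \<comment> \<open>From n = 3 on, \<open>real n - 3\<close> is nonnegative, so replacing
    \<open>p n\<close> by its lower bound can only increase the term.\<close>
  with p eventually_ge_at_top[of 3]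
  show "eventually (\<lambda>n. norm (2 * real n * exp (- p n * (real n - 3) / 14)) \<le> 1 / real n ^ 2) sequentially"
  proof eventually_elim
    case (elim n)
    have "2 * real n * exp (- p n * (real n - 3) / 14)
        \<le> 2 * real n * exp (- (K * (ln (real n) / real n) powr g) * (real n - 3) / 14)"
      using elim by (intro mult_left_mono) (auto intro!: mult_right_mono)
    also have "\<dots> \<le> 1 / real n ^ 2"
      by (rule elim)
    finally show ?case by simp
  qed
qed

section \<open>Almost sure convergence\<close>

text \<open>Common form of both claims: the prescribed radii are the case C = 1, the alternative
  sequences bring their own C.\<close>

lemma (in prob_space) AE_corr_dim_est_tendsto:
  fixes X :: "nat \<Rightarrow> 'a \<Rightarrow> real ^ 'd"
  assumes indep: "indep_vars (\<lambda>_. borel) X {1..}"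
    and distr: "\<And>i. 1 \<le> i \<Longrightarrow> distr M borel (X i) = P"
    and dim: "has_corr_dim P (ereal D)" and D: "0 < D" and \<beta>: "0 < \<beta>" and C: "0 < C"
    and lim: "r \<longlonglongrightarrow> 0"
    and r_ge: "\<And>n. 1 \<le> n \<Longrightarrow> C * (ln (real n) / real n) powr (1 / ((1 + \<beta>) * D)) \<le> r n"
  shows "AE \<omega> in M. (\<lambda>n. corr_dim_est (\<lambda>i. X i \<omega>) n (r n)) \<longlonglongrightarrow> D"
proof -
  \<comment> \<open>\<open>D'\<close> lies strictly between D and (1 + \<beta>) D. Raising the
    prescribed radius to the power \<open>D'\<close> gives ln n / n to the power \<open>g\<close> <
    1.\<close>
  define D' where "D' = (1 + \<beta> / 2) * D"
  define g where "g = (1 + \<beta> / 2) / (1 + \<beta>)"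
  have D': "0 < D'" "D < D'"
    using D \<beta> by (simp_all add: D'_def add_pos_pos)
  have g: "g < 1" "1 / ((1 + \<beta>) * D) * D' = g"
    using D \<beta> by (simp_all add: g_def D'_def)
  have r_pos: "eventually (\<lambda>n. 0 < r n) sequentially"
    \<comment> \<open>At n = 1 the lower bound on the radius is 0, since ln 1 = 0; positivity starts
      at n = 2.\<close>
    using eventually_ge_at_top[of 2]
  proof eventually_elim
    case (elim n)
    then have "0 < C * (ln (real n) / real n) powr (1 / ((1 + \<beta>) * D))"
      using C by simp
    with elim r_ge[of n] show ?case by simp
  qed
  have r0: "filterlim r (at_right 0) sequentially"
    using lim r_pos by (auto simp: filterlim_at elim: eventually_mono)
  define p where "p n = corr_prob P (r n)" for n
  have p_pos: "eventually (\<lambda>n. 0 < p n) sequentially"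
    unfolding p_def using filterlim_iff[THEN iffD1, OF r0] has_corr_dim_imp_corr_prob_pos[OF dim D] by blast
  have p_lim: "(\<lambda>n. ln (p n) / ln (r n)) \<longlonglongrightarrow> D"
    unfolding p_def using filterlim_compose[OF dim[unfolded has_corr_dim_iff] r0] .
  have "eventually (\<lambda>n. r n powr D' \<le> p n) sequentially"
    unfolding p_def using filterlim_iff[THEN iffD1, OF r0] has_corr_dim_imp_powr_le_corr_prob[OF dim D D'(2)] by blast
  then have p_ge: "eventually (\<lambda>n. C powr D' * (ln (real n) / real n) powr g \<le> p n) sequentially"
    using eventually_ge_at_top[of 2]
  proof eventually_elim
    case (elim n)
    have "C powr D' * (ln (real n) / real n) powr g
        = (C * (ln (real n) / real n) powr (1 / ((1 + \<beta>) * D))) powr D'"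
      using C elim by (subst powr_mult) (auto simp: powr_powr g(2)[simplified])
    also have "\<dots> \<le> r n powr D'"
      using C D' elim r_ge[of n] by (intro powr_mono2) auto
    finally show ?case using elim by simp
  qed
  define good where "good n \<omega> \<longleftrightarrow>
    p n / 2 \<le> emp_corr_prob (\<lambda>i. X i \<omega>) n (r n) \<and> emp_corr_prob (\<lambda>i. X i \<omega>) n (r n) \<le> 2 * p n" for n \<omega>
  \<comment> \<open>Below n = 2 there are no pairs and any event will do; quantifying over all n
    allows a whole sequence of exceptional events to be chosen.\<close>
  have "\<forall>n. \<exists>A. A \<in> events \<and> (2 \<le> n \<longrightarrow>
      prob A \<le> 2 * real n * exp (- p n * (real n - 3) / 14) \<and> (\<forall>\<omega>\<in>space M - A. good n \<omega>))"
  proof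
    fix n
    show "\<exists>A. A \<in> events \<and> (2 \<le> n \<longrightarrow>
      prob A \<le> 2 * real n * exp (- p n * (real n - 3) / 14) \<and> (\<forall>\<omega>\<in>space M - A. good n \<omega>))"
    proof (cases "2 \<le> n")
      case True
      from emp_corr_prob_deviation[OF indep distr True, of "r n"] show ?thesis
        unfolding good_def p_def by metis
    qed auto
  qed
  then obtain A where A: "\<And>n. A n \<in> events"
    "\<And>n. 2 \<le> n \<Longrightarrow> prob (A n) \<le> 2 * real n * exp (- p n * (real n - 3) / 14)"
    "\<And>n \<omega>. 2 \<le> n \<Longrightarrow> \<omega> \<in> space M - A n \<Longrightarrow> good n \<omega>"
    by metis
  have "eventually (\<lambda>n. norm (prob (A n)) \<le> 2 * real n * exp (- p n * (real n - 3) / 14)) sequentially"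
    using eventually_ge_at_top[of 2] by eventually_elim (use A(2) in simp)
  moreover have "summable (\<lambda>n. 2 * real n * exp (- p n * (real n - 3) / 14))"
    using C by (intro summable_stretched_exp[OF _ g(1) p_ge]) simp
  ultimately have "summable (\<lambda>n. prob (A n))"
    by (rule summable_comparison_test_ev)
  then have "AE \<omega> in M. eventually (\<lambda>n. \<omega> \<in> space M - A n) sequentially"
    using A(1) by (intro borel_cantelli_AE1) (auto simp: less_top[symmetric])
  then show ?thesis
  proof eventually_elim
    case (elim \<omega>)
    then have "eventually (\<lambda>n. good n \<omega>) sequentially"
      using eventually_ge_at_top[of 2] by eventually_elim (rule A(3))
    then show ?case
      unfolding corr_dim_est_def good_def by (rule tendsto_ln_ratio_perturb[OF p_lim r0 p_pos])
  qed
qed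

theorem theorem3:
  fixes M :: "'w measure"
    and X :: "nat \<Rightarrow> 'w \<Rightarrow> real ^ 'd"
    and P :: "(real ^ 'd) measure"
    and D \<beta> :: real
    and r :: "nat \<Rightarrow> real"
  assumes "prob_space M"
    and "prob_space.indep_vars M (\<lambda>_. borel) X {1..}"
    and "\<And>i. i \<ge> 1 \<Longrightarrow> distr M borel (X i) = P"
    and "has_corr_dim P (ereal D)" and "0 < D"
    and "0 < \<beta>"
    and "\<And>n. r n = (ln (real n) / real n) powr (1 / ((1 + \<beta>) * D))"
  shows "(AE \<omega> in M. (\<lambda>n. corr_dim_est (\<lambda>i. X i \<omega>) n (r n)) \<longlonglongrightarrow> D) \<and>
    (\<forall>r' :: nat \<Rightarrow> real. decseq r' \<longrightarrow> r' \<longlonglongrightarrow> 0 \<longrightarrow> (\<exists>C>0. \<forall>n\<ge>1. r' n \<ge> C * r n) \<longrightarrow>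
       (AE \<omega> in M. (\<lambda>n. corr_dim_est (\<lambda>i. X i \<omega>) n (r' n)) \<longlonglongrightarrow> D))"
proof -
  \<comment> \<open>Folding the formula for \<open>r\<close> turns the growth condition into
    \<open>C * r n\<close> \<le> radius, the form in which the alternative sequences are
    given.\<close>
  note main = prob_space.AE_corr_dim_est_tendsto[OF assms(1-6), folded assms(7)]
  have "0 < 1 / ((1 + \<beta>) * D)"
    using assms(5,6) by simp
  then have "r \<longlonglongrightarrow> 0"
    unfolding assms(7) by real_asymp
  then have "AE \<omega> in M. (\<lambda>n. corr_dim_est (\<lambda>i. X i \<omega>) n (r n)) \<longlonglongrightarrow> D"
    by (intro main[of 1]) auto
  then show ?thesis
    using main by blast
qed

end
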